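(* For any two points $u$ and $v$ of $\mathcal{E}(S,\mathcal{T})_1$, there exists a bigeodesic in $\mathcal{E}(S,\mathcal{T})_1$ joining them with respect to $\eta$, which is expressed as $t\mapsto\lambda(t)\bigl((1-t)u+tv\bigr)$, $t\in[0,1]$, for some function $\lambda:[0,1]\to\mathbb{R}_+^*$.
   Context: $\mathbb{R}_+^*$ denotes the set of positive reals. Let $S$ be a compact surface, possibly with boundary, and $\mathcal{T}$ a finite triangulation of $S$ with set of edges $E(\mathcal{T})=\{e_i\}$. Fix a set $\mathcal{J}$ of ordered triples $(i,j,k)$ of edge indices such that: (1) for each $(i,j,k)\in\mathcal{J}$, $e_i,e_j,e_k$ are the edges of a face of $\mathcal{T}$; (2) if a face has edges $e_i,e_j,e_k$, some permutation of $(i,j,k)$ is in $\mathcal{J}$; (3) if $(i,j,k)\in\mathcal{J}$, no odd permutation of it is in $\mathcal{J}$; (4) if $(i,j,k)\in\mathcal{J}$, all even permutations of it are in $\mathcal{J}$. $\mathcal{E}(S,\mathcal{T})$ is the set of singular Euclidean metrics $\mu$ on $S$ adapted to $\mathcal{T}$ (each face is a Euclidean triangle; the metric is locally Euclidean except perhaps at the vertices); such $\mu$ is determined by its edge lengths $l_\mu(e_i)>0$, which are arbitrary subject to the strict triangle inequalities for each face. It is identified with its image in $(\mathbb{R}_+^* )^{\mathcal{J}}$ under the injective map $\mu\mapsto(A_{ijk})$, $A_{ijk}=\frac{l_\mu(e_j)+l_\mu(e_k)-l_\mu(e_i)}{2}$. This image is the set of $(A_{ijk})\in(\mathbb{R}_+^*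 )^{\mathcal{J}}$ with $A_{jki}+A_{kij}=A_{j'k'i}+A_{k'ij'}$ whenever $(i,j,k),(i,j',k')\in\mathcal{J}$ with $j\ne j'$, $k\neq k'$ (both sides equal the length of the interior edge $e_i$). Linear combinations such as $(1-t)u+tv$ are taken in $\mathbb{R}^{\mathcal{J}}$. $\mathrm{Ar}(A)$ is the area of the singular flat metric corresponding to $A$, i.e. the sum over the faces of $\mathcal{T}$ (with edges $e_i,e_j,e_k$, $(i,j,k)\in\mathcal{J}$) of $\sqrt{(A_{ijk}+A_{jki}+A_{kij})A_{ijk}A_{jki}A_{kij}}$. Set $\mathcal{E}(S,\mathcal{T})_1=\{A\in\mathcal{E}(S,\mathcal{T}):\mathrm{Ar}(A)=1\}$. The (not necessarily symmetric) metric $\eta$ on it is $\eta(A,B)=\log\max_{(i,j,k)\in\mathcal{J}}\frac{B_{ijk}}{A_{ijk}}$, and $\mathcal{E}(S,\mathcal{T})_1$ carries the topology induced by $\max\{\eta(A,B),\eta(B,A)\}$. A continuous path $\alpha:[a,b]\to X$ in a (possibly non-symmetric) metric space $(X,d)$ is a geodesic if $d(\alpha(r),\alpha(w))=d(\alpha(r),\alpha(s))+d(\alpha(s),\alpha(w))$ for all $r\le s\le w$ in $[a,b]$. It is a bigeodesic if both $\alpha$ and the same path traversed in the reverse direction are geodesics. A path $\alpha:[a,b]\to X$ joins $x$ and $y$ if $\alpha(a)=x$ and $\alpha(b)=y$. *)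

theory Defs
  imports "HOL-Analysis.Analysis"
begin

definition compact_surface :: "'s topology \<Rightarrow> bool" where
  "compact_surface S \<longleftrightarrow>
     compact_space S \<and> Hausdorff_space S \<and> second_countable S \<and>
     (\<forall>x\<in>topspace S. \<exists>U. openin S U \<and> x \<in> U \<and>
        (\<exists>W. openin (top_of_set {z::complex. 0 \<le> Im z}) W \<and>
             subtopology S U homeomorphic_space top_of_set W))"

(* Edges and faces are recorded as open cells, that is, without their boundary. *)
record 's cell_triangulation =
  verts :: "'s set"
  edges :: "'s set set"
  faces :: "'s set set"

abbreviation std_triangle :: "complex set" where
  "std_triangle \<equiv> convex hull {0, 1, \<i>}"

(* The open cell f is the image of an open triangle under a characteristic map of the
   closed triangle that carries the three open sides bijectively onto a, b and c.
   The map need not be injective on the vertices, and faces may share several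
   edges, so triangulations that are not simplicial complexes are included.
   The three sides are interchangeable, by precomposing with an affine map. *)
definition face_with_edges ::
  "'s topology \<Rightarrow> 's cell_triangulation \<Rightarrow> 's set \<Rightarrow> 's set \<Rightarrow> 's set \<Rightarrow> 's set \<Rightarrow> bool" where
  "face_with_edges S T f a b c \<longleftrightarrow>
     f \<in> faces T \<and> a \<in> edges T \<and> b \<in> edges T \<and> c \<in> edges T \<and>
     (\<exists>\<phi>. continuous_map (top_of_set std_triangle) S \<phi> \<and>
          bij_betw \<phi> (interior std_triangle) f \<and>
          bij_betw \<phi> (open_segment 1 \<i>) a \<and>
          bij_betw \<phi> (open_segment \<i> 0) b \<and>
          bij_betw \<phi> (open_segment 0 1) c \<and>
          \<phi> ` {0, 1, \<i>} \<subseteq> verts T)"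

definition finite_triangulation :: "'s topology \<Rightarrow> 's cell_triangulation \<Rightarrow> bool" where
  "finite_triangulation S T \<longleftrightarrow>
     finite (verts T) \<and> finite (edges T) \<and> finite (faces T) \<and>
     edges T \<inter> faces T = {} \<and>
     partition_on (topspace S) ((\<lambda>v. {v}) ` verts T \<union> edges T \<union> faces T) \<and>
     (\<forall>f\<in>faces T. \<exists>a b c. face_with_edges S T f a b c) \<and>
     (\<forall>a\<in>edges T. \<exists>f b c. face_with_edges S T f a b c)"

(* The conditions on the set J of triples of edge indices; e i is the edge with index i,
   and I is the set of all indices. *)
definition admissible_triples ::
  "'s topology \<Rightarrow> 's cell_triangulation \<Rightarrow> 'i set \<Rightarrow> ('i \<Rightarrow> 's set) \<Rightarrow> ('i \<times> 'i \<times> 'i) set \<Rightarrow> bool" where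
  "admissible_triples S T I e J \<longleftrightarrow>
     (\<forall>i j k. (i, j, k) \<in> J \<longrightarrow>
        i \<in> I \<and> j \<in> I \<and> k \<in> I \<and> (\<exists>f. face_with_edges S T f (e i) (e j) (e k))) \<and>
     (\<forall>f. \<forall>i\<in>I. \<forall>j\<in>I. \<forall>k\<in>I. face_with_edges S T f (e i) (e j) (e k) \<longrightarrow>
        J \<inter> {(i, j, k), (j, k, i), (k, i, j), (j, i, k), (i, k, j), (k, j, i)} \<noteq> {}) \<and>
     (\<forall>i j k. (i, j, k) \<in> J \<longrightarrow> (j, i, k) \<notin> J \<and> (i, k, j) \<notin> J \<and> (k, j, i) \<notin> J) \<and>
     (\<forall>i j k. (i, j, k) \<in> J \<longrightarrow> (j, k, i) \<in> J \<and> (k, i, j) \<in> J)"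

(* A singular Euclidean metric adapted to T is given by its edge lengths. *)
definition edge_lengths ::
  "'s topology \<Rightarrow> 's cell_triangulation \<Rightarrow> ('s set \<Rightarrow> real) set" where
  "edge_lengths S T =
     {l. (\<forall>a\<in>edges T. 0 < l a) \<and>
         (\<forall>f a b c. face_with_edges S T f a b c \<longrightarrow>
            l a < l b + l c \<and> l b < l c + l a \<and> l c < l a + l b)}"

definition A_coords ::
  "('i \<Rightarrow> 's set) \<Rightarrow> ('i \<times> 'i \<times> 'i) set \<Rightarrow> ('s set \<Rightarrow> real) \<Rightarrow> ('i \<times> 'i \<times> 'i \<Rightarrow> real)" where
  "A_coords e J l = (\<lambda>(i, j, k)\<in>J. (l (e j) + l (e k) - l (e i)) / 2)"

(* Points of the J-fold power of the reals are extensional functions on J. *)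
definition metric_space_E ::
  "'s topology \<Rightarrow> 's cell_triangulation \<Rightarrow> ('i \<Rightarrow> 's set) \<Rightarrow> ('i \<times> 'i \<times> 'i) set
     \<Rightarrow> ('i \<times> 'i \<times> 'i \<Rightarrow> real) set" where
  "metric_space_E S T e J = A_coords e J ` edge_lengths S T"

definition triangle_area ::
  "('i \<times> 'i \<times> 'i \<Rightarrow> real) \<Rightarrow> 'i \<times> 'i \<times> 'i \<Rightarrow> real" where
  "triangle_area A = (\<lambda>(i, j, k).
     sqrt ((A (i, j, k) + A (j, k, i) + A (k, i, j)) * A (i, j, k) * A (j, k, i) * A (k, i, j)))"

(* The triples of J belonging to one face differ by cyclic permutations, under which
   triangle_area is invariant, so the choice does not matter. *)
definition surface_area ::
  "'s topology \<Rightarrow> 's cell_triangulation \<Rightarrow> ('i \<Rightarrow> 's set) \<Rightarrow> ('i \<times> 'i \<times> 'i) set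
     \<Rightarrow> ('i \<times> 'i \<times> 'i \<Rightarrow> real) \<Rightarrow> real" where
  "surface_area S T e J A =
     (\<Sum>f\<in>faces T. triangle_area A
        (SOME (i, j, k). (i, j, k) \<in> J \<and> face_with_edges S T f (e i) (e j) (e k)))"

definition metric_space_E1 ::
  "'s topology \<Rightarrow> 's cell_triangulation \<Rightarrow> ('i \<Rightarrow> 's set) \<Rightarrow> ('i \<times> 'i \<times> 'i) set
     \<Rightarrow> ('i \<times> 'i \<times> 'i \<Rightarrow> real) set" where
  "metric_space_E1 S T e J = {A \<in> metric_space_E S T e J. surface_area S T e J A = 1}"

definition eta :: "'p set \<Rightarrow> ('p \<Rightarrow> real) \<Rightarrow> ('p \<Rightarrow> real) \<Rightarrow> real" where
  "eta J A B = ln (Max ((\<lambda>p. B p / A p) ` J))"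

(* The value off X is irrelevant; it is 0 because the locale Metric_space asks for
   nonnegativity on the whole type. *)
definition sym_dist :: "'x set \<Rightarrow> ('x \<Rightarrow> 'x \<Rightarrow> real) \<Rightarrow> 'x \<Rightarrow> 'x \<Rightarrow> real" where
  "sym_dist X d x y = (if x \<in> X \<and> y \<in> X then max (d x y) (d y x) else 0)"

definition asym_topology :: "'x set \<Rightarrow> ('x \<Rightarrow> 'x \<Rightarrow> real) \<Rightarrow> 'x topology" where
  "asym_topology X d = Metric_space.mtopology X (sym_dist X d)"

definition geodesic ::
  "'x set \<Rightarrow> ('x \<Rightarrow> 'x \<Rightarrow> real) \<Rightarrow> real \<Rightarrow> real \<Rightarrow> (real \<Rightarrow> 'x) \<Rightarrow> bool" where
  "geodesic X d a b \<alpha> \<longleftrightarrow>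
     continuous_map (top_of_set {a..b}) (asym_topology X d) \<alpha> \<and>
     (\<forall>r s w. a \<le> r \<and> r \<le> s \<and> s \<le> w \<and> w \<le> b \<longrightarrow>
        d (\<alpha> r) (\<alpha> w) = d (\<alpha> r) (\<alpha> s) + d (\<alpha> s) (\<alpha> w))"

definition bigeodesic ::
  "'x set \<Rightarrow> ('x \<Rightarrow> 'x \<Rightarrow> real) \<Rightarrow> real \<Rightarrow> real \<Rightarrow> (real \<Rightarrow> 'x) \<Rightarrow> bool" where
  "bigeodesic X d a b \<alpha> \<longleftrightarrow> geodesic X d a b \<alpha> \<and> geodesic X d a b (\<lambda>t. \<alpha> (a + b - t))"

definition joins :: "real \<Rightarrow> real \<Rightarrow> (real \<Rightarrow> 'x) \<Rightarrow> 'x \<Rightarrow> 'x \<Rightarrow> bool" where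
  "joins a b \<alpha> x y \<longleftrightarrow> \<alpha> a = x \<and> \<alpha> b = y"

lemma Metric_space_sym_dist_eta:
  assumes "finite J" "J \<noteq> {}" and X: "X \<subseteq> (J \<rightarrow>\<^sub>E {0<..})"
  shows "Metric_space X (sym_dist X (eta J))"
proof -
  have pos: "0 < A p" if "A \<in> X" "p \<in> J" for A p
    using X that by (auto simp: PiE_iff)
  let ?M = "\<lambda>A B. Max ((\<lambda>p. B p / A p) ` J)"
  have ge: "B p / A p \<le> ?M A B" if "p \<in> J" for A B p
    using that assms by (intro Max_ge) auto
  have Mpos: "0 < ?M A B" if "A \<in> X" "B \<in> X" for A B
    using assms pos that by (subst Max_gr_iff) auto
  have tri: "eta J A C \<le> eta J A B + eta J B C" if "A \<in> X" "B \<in> X" "C \<in> X" for A B C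
  proof -
    have "C p / A p \<le> ?M A B * ?M B C" if "p \<in> J" for p
    proof -
      have "C p / A p = (B p / A p) * (C p / B p)"
        using pos[OF \<open>B \<in> X\<close> that] by simp
      also have "\<dots> \<le> ?M A B * ?M B C"
        using ge that pos \<open>A \<in> X\<close> \<open>B \<in> X\<close> \<open>C \<in> X\<close> Mpos by (intro mult_mono) (auto intro: less_imp_le)
      finally show ?thesis .
    qed
    then have "?M A C \<le> ?M A B * ?M B C"
      using assms by (subst Max_le_iff) auto
    then have "ln (?M A C) \<le> ln (?M A B * ?M B C)"
      using Mpos that by simp
    then show ?thesis
      using Mpos[OF that(1,2)] Mpos[OF that(2,3)] by (simp add: eta_def ln_mult)
  qed
  have le0: "B p \<le> A p" if "eta J A B \<le> 0" "A \<in> X" "B \<in> X" "p \<in> J" for A B p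
  proof -
    have "?M A B \<le> 1"
      using that Mpos[OF that(2,3)] by (simp add: eta_def)
    then have "B p / A p \<le> 1"
      using ge[OF that(4), of B A] by linarith
    then show ?thesis
      using pos[OF that(2,4)] by (simp add: divide_le_eq)
  qed
  have self: "eta J A A = 0" if "A \<in> X" for A
  proof -
    have "(\<lambda>p. A p / A p) ` J = {1}"
      using pos[OF that] assms(2) by force
    then show ?thesis by (simp add: eta_def)
  qed
  have nonneg: "0 \<le> max (eta J A B) (eta J B A)" if "A \<in> X" "B \<in> X" for A B
    using tri[OF that(1,2,1)] self[OF that(1)] by linarith
  show ?thesis
  proof
    show "0 \<le> sym_dist X (eta J) A B" for A B
      using nonneg by (simp add: sym_dist_def)
    show "sym_dist X (eta J) A B = sym_dist X (eta J) B A" for A B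
      by (simp add: sym_dist_def max.commute)
    show "sym_dist X (eta J) A B = 0 \<longleftrightarrow> A = B" if "A \<in> X" "B \<in> X" for A B
    proof
      assume "sym_dist X (eta J) A B = 0"
      then have "eta J A B \<le> 0" "eta J B A \<le> 0"
        using that by (auto simp: sym_dist_def max_def split: if_splits)
      then have "A p = B p" if "p \<in> J" for p
        using le0 that \<open>A \<in> X\<close> \<open>B \<in> X\<close> by (meson order_antisym)
      then show "A = B"
        using X that by (intro PiE_ext[of A J "\<lambda>_. {0<..}" B]) auto
    qed (use self that in \<open>simp add: sym_dist_def\<close>)
    show "sym_dist X (eta J) A C \<le> sym_dist X (eta J) A B + sym_dist X (eta J) B C"
      if "A \<in> X" "B \<in> X" "C \<in> X" for A B C
      using tri[OF that] tri[OF that(3,2,1)] that unfolding sym_dist_def by (smt (verit))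
  qed
qed

(* The description of the image by equations. The last hypothesis holds when T is a
   simplicial complex, since then two faces have at most one edge in common. *)
lemma metric_space_E_eq:
  assumes T: "finite_triangulation S T" and e: "bij_betw e I (edges T)"
    and J: "admissible_triples S T I e J"
    and simplicial: "\<And>i j k j' k'. (i, j, k) \<in> J \<Longrightarrow> (i, j', k') \<in> J \<Longrightarrow>
      (j = j' \<and> k = k') \<or> (j \<noteq> j' \<and> k \<noteq> k')"
  shows "metric_space_E S T e J =
    {A \<in> J \<rightarrow>\<^sub>E {0<..}. \<forall>i j k j' k'. (i, j, k) \<in> J \<longrightarrow> (i, j', k') \<in> J \<longrightarrow> j \<noteq> j' \<longrightarrow> k \<noteq> k' \<longrightarrow>
       A (j, k, i) + A (k, i, j) = A (j', k', i) + A (k', i, j')}"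
    (is "_ = ?R")
proof
  have cyc: "(j, k, i) \<in> J" "(k, i, j) \<in> J" if "(i, j, k) \<in> J" for i j k
    using J that unfolding admissible_triples_def by blast+
  have face: "\<exists>f. face_with_edges S T f (e i) (e j) (e k)" "i \<in> I" if "(i, j, k) \<in> J" for i j k
    using J that unfolding admissible_triples_def by blast+
  show "metric_space_E S T e J \<subseteq> ?R"
  proof
    fix A assume "A \<in> metric_space_E S T e J"
    then obtain l where l: "l \<in> edge_lengths S T" and A: "A = A_coords e J l"
      by (auto simp: metric_space_E_def)
    have 1: "0 < A (i, j, k)" if ijk: "(i, j, k) \<in> J" for i j k
    proof -
      obtain f where "face_with_edges S T f (e i) (e j) (e k)"
        using face(1)[OF ijk] by blast
      then have "l (e i) < l (e j) + l (e k)"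
        using l unfolding edge_lengths_def by blast
      then show ?thesis using ijk by (simp add: A A_coords_def)
    qed
    have 2: "A (j, k, i) + A (k, i, j) = l (e i)" if "(i, j, k) \<in> J" for i j k
      using cyc[OF that] by (simp add: A A_coords_def field_simps)
    have 3: "A \<in> extensional J"
      unfolding A A_coords_def by (rule restrict_extensional)
    have "A \<in> J \<rightarrow>\<^sub>E {0<..}"
    proof (rule PiE_I)
      fix p assume "p \<in> J"
      then show "A p \<in> {0<..}" using 1 by (cases p) simp
    qed (rule extensional_arb[OF 3])
    moreover have "A (j, k, i) + A (k, i, j) = A (j', k', i) + A (k', i, j')"
      if "(i, j, k) \<in> J" "(i, j', k') \<in> J" for i j k j' k'
      using 2[OF that(1)] 2[OF that(2)] by linarith
    ultimately show "A \<in> ?R" by blast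
  qed
  show "?R \<subseteq> metric_space_E S T e J"
  proof
    fix A assume A: "A \<in> ?R"
    then have pos: "0 < A p" if "p \<in> J" for p
      using that by (auto simp: PiE_iff)
    have ext: "A \<in> extensional J" using A by (auto simp: PiE_iff)
    define P where "P a t \<longleftrightarrow> (\<exists>i j k. (i, j, k) \<in> J \<and> a = e i \<and> t = A (j, k, i) + A (k, i, j))" for a t
    define l where "l a = (SOME t. P a t)" for a
    have l: "l (e i) = A (j, k, i) + A (k, i, j)" if ijk: "(i, j, k) \<in> J" for i j k
    proof -
      have "P (e i) (l (e i))"
        unfolding l_def by (rule someI[of "P (e i)"]) (use ijk P_def in blast)
      then obtain i' j' k' where 1: "(i', j', k') \<in> J" "e i = e i'"
        and 2: "l (e i) = A (j', k', i') + A (k', i', j')"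
        unfolding P_def by blast
      have "i' = i"
        using inj_onD[OF bij_betw_imp_inj_on[OF e] 1(2)] face(2)[OF 1(1)] face(2)[OF ijk] by simp
      show ?thesis
      proof (cases "j = j' \<and> k = k'")
        case True
        then show ?thesis using 2 \<open>i' = i\<close> by simp
      next
        case False
        have ijk': "(i, j', k') \<in> J"
          using 1(1) \<open>i' = i\<close> by simp
        then have "j \<noteq> j'" "k \<noteq> k'"
          using False simplicial[OF ijk] by blast+
        then have "A (j, k, i) + A (k, i, j) = A (j', k', i) + A (k', i, j')"
          using A ijk ijk' by blast
        then show ?thesis using 2 \<open>i' = i\<close> by simp
      qed
    qed
    have sides: "l a < l b + l c \<and> l b < l c + l a \<and> l c < l a + l b \<and> 0 < l a"
      if f: "face_with_edges S T f a b c" for f a b c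
    proof -
      have "a \<in> edges T" "b \<in> edges T" "c \<in> edges T"
        using f unfolding face_with_edges_def by blast+
      then obtain i j k where I: "i \<in> I" "j \<in> I" "k \<in> I" and abc: "a = e i" "b = e j" "c = e k"
        unfolding bij_betw_imp_surj_on[OF e, symmetric] by (elim imageE) metis
      have "J \<inter> {(i, j, k), (j, k, i), (k, i, j), (j, i, k), (i, k, j), (k, j, i)} \<noteq> {}"
        using J[unfolded admissible_triples_def, THEN conjunct2, THEN conjunct1, rule_format, OF I]
          f[unfolded abc] by simp
      then consider "(i, j, k) \<in> J" | "(j, i, k) \<in> J"
        using cyc(1)[of j k i] cyc(2)[of j k i] cyc(1)[of k i j] cyc(1)[of i k j] cyc(2)[of i k j]
          cyc(1)[of k j i] cyc(2)[of k j i] by auto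
      then show ?thesis
      proof cases
        case 1
        note c = 1 cyc[OF 1]
        have "l a < l b + l c \<and> l b < l c + l a \<and> l c < l a + l b \<and> 0 < l a"
          unfolding abc l[OF c(1)] l[OF c(2)] l[OF c(3)]
          using pos[OF c(1)] pos[OF c(2)] pos[OF c(3)] by linarith
        then show ?thesis .
      next
        case 2
        note c = 2 cyc[OF 2]
        have "l a < l b + l c \<and> l b < l c + l a \<and> l c < l a + l b \<and> 0 < l a"
          unfolding abc l[OF c(1)] l[OF c(2)] l[OF c(3)]
          using pos[OF c(1)] pos[OF c(2)] pos[OF c(3)] by linarith
        then show ?thesis .
      qed
    qed
    have "l \<in> edge_lengths S T"
      unfolding edge_lengths_def
    proof (intro CollectI conjI)
      show "\<forall>a\<in>edges T. 0 < l a"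
      proof
        fix a assume "a \<in> edges T"
        then obtain f b c where "face_with_edges S T f a b c"
          using T unfolding finite_triangulation_def by blast
        from sides[OF this] show "0 < l a" by blast
      qed
      show "\<forall>f a b c. face_with_edges S T f a b c \<longrightarrow>
          l a < l b + l c \<and> l b < l c + l a \<and> l c < l a + l b"
        by (intro allI impI) (use sides in simp)
    qed
    moreover have "A = A_coords e J l"
    proof (rule extensionalityI[OF ext])
      show "A_coords e J l \<in> extensional J" by (simp add: A_coords_def)
      fix p assume p: "p \<in> J"
      obtain i j k where ijk: "p = (i, j, k)" by (cases p)
      note c = p[unfolded ijk] cyc[OF p[unfolded ijk]]
      show "A p = A_coords e J l p"
        using c l[OF c(1)] l[OF c(2)] l[OF c(3)] by (simp add: ijk A_coords_def)
    qed
    ultimately show "A \<in> metric_space_E S T e J"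
      by (auto simp: metric_space_E_def)
  qed
qed

end

(*
  Along the segment x(t) = (1-t) u + t v the ratio x_p(s) / x_p(r), for r <= s, is an
  increasing function of v_p / u_p. Hence the maximum over p is attained at an index that
  does not depend on r and s (one maximising v_p / u_p), and for the reversed segment at one
  minimising v_p / u_p. Rescaling by lambda multiplies all ratios by the same factor, so eta
  along the rescaled segment is a difference of values of a single function, the logarithm of
  one coordinate, in either direction. As the cone of metrics is convex and the area is
  positive and homogeneous of degree 2, lambda(t) = Ar(x(t))^(-1/2) puts the path on the
  level set Ar = 1.
*)
theory Submission
  imports Defs
begin

section \<open>Bigeodesics from potentials, applied to rescaled segments\<close>

text \<open>Differences of a potential telescope, which gives additivity of distances. Since
  \<open>d\<close> need not be symmetric, the two directions get separate potentials
  \<open>g\<close> and \<open>h\<close>; their continuity yields continuity of the path.\<close>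

lemma bigeodesicI_potential:
  fixes \<alpha> :: "real \<Rightarrow> 'x"
  assumes M: "Metric_space X (sym_dist X d)"
    and \<alpha>: "\<And>t. t \<in> {a..b} \<Longrightarrow> \<alpha> t \<in> X"
    and g: "continuous_on {a..b} g" and h: "continuous_on {a..b} h"
    and fwd: "\<And>r s. a \<le> r \<Longrightarrow> r \<le> s \<Longrightarrow> s \<le> b \<Longrightarrow> d (\<alpha> r) (\<alpha> s) = g s - g r"
    and bwd: "\<And>r s. a \<le> r \<Longrightarrow> r \<le> s \<Longrightarrow> s \<le> b \<Longrightarrow> d (\<alpha> s) (\<alpha> r) = h r - h s"
  shows "bigeodesic X d a b \<alpha>"
proof -
  interpret Metric_space X "sym_dist X d" by (rule M)
  \<comment> \<open>The symmetrised distance is the maximum of two potential differences, one in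
    \<open>g\<close> and one in \<open>h\<close>, hence at most the sum of their absolute
    values.\<close>
  have bound: "sym_dist X d (\<alpha> x) (\<alpha> y) \<le> \<bar>g y - g x\<bar> + \<bar>h y - h x\<bar>"
    if "x \<in> {a..b}" "y \<in> {a..b}" for x y
    using \<alpha> that fwd[of x y] bwd[of x y] fwd[of y x] bwd[of y x]
    by (cases "x \<le> y") (auto simp: sym_dist_def)
  have cont: "continuous_map (top_of_set {a..b}) (asym_topology X d) \<alpha>"
    unfolding asym_topology_def continuous_map_to_metric
  proof (intro ballI allI impI)
    fix x and \<epsilon> :: real
    assume x: "x \<in> topspace (top_of_set {a..b})" and "0 < \<epsilon>"
    let ?f = "\<lambda>y. \<bar>g y - g x\<bar> + \<bar>h y - h x\<bar>"
    let ?U = "{a..b} \<inter> ?f -` {..<\<epsilon>}"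
    have "continuous_on {a..b} ?f"
      by (intro continuous_intros g h)
    then have "openin (top_of_set {a..b}) ?U"
      by (rule continuous_openin_preimage_gen) simp
    moreover have "\<alpha> y \<in> mball (\<alpha> x) \<epsilon>" if "y \<in> ?U" for y
      using bound[of x y] \<alpha> x that by (auto simp: in_mball)
    ultimately show "\<exists>U. openin (top_of_set {a..b}) U \<and> x \<in> U \<and> (\<forall>y\<in>U. \<alpha> y \<in> mball (\<alpha> x) \<epsilon>)"
      using x \<open>0 < \<epsilon>\<close> by (intro exI[of _ ?U]) auto
  qed
  have "continuous_map (top_of_set {a..b}) (top_of_set {a..b}) (\<lambda>t. a + b - t)"
    by (simp add: continuous_map_in_subtopology continuous_on_op_minus image_subset_iff Pi_iff)
  from continuous_map_compose[OF this cont]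
  have "continuous_map (top_of_set {a..b}) (asym_topology X d) (\<lambda>t. \<alpha> (a + b - t))"
    by (simp add: comp_def)
  \<comment> \<open>Additivity along the path telescopes in \<open>g\<close>. Reversal turns
    \<open>r\<close> \<le> \<open>s\<close> \<le> \<open>w\<close> into \<open>a + b - w\<close>
    \<le> \<open>a + b - s\<close> \<le> \<open>a + b - r\<close>, so the reversed path telescopes
    in \<open>h\<close>.\<close>
  then show ?thesis
    using cont unfolding bigeodesic_def geodesic_def by (simp add: fwd bwd)
qed

text \<open>Once a maximising index is known, \<open>eta\<close> takes the form of a potential
  difference, the potential being the logarithm of that coordinate.\<close>

lemma eta_eqI:
  assumes "finite J" "q \<in> J" "\<And>p. p \<in> J \<Longrightarrow> B p / A p \<le> B q / A q" "0 < A q" "0 < B q"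
  shows "eta J A B = ln (B q) - ln (A q)"
proof -
  have "Max ((\<lambda>p. B p / A p) ` J) = B q / A q"
    using assms by (intro Max_eqI) auto
  then show ?thesis
    using assms by (simp add: eta_def ln_div)
qed

lemma segment_ratio_mono:
  fixes a a' b b' r s :: real
  assumes "0 < a" "0 < b" "0 < a'" "0 < b'" "b / a \<le> b' / a'" "0 \<le> r" "r \<le> s" "s \<le> 1"
  shows "((1 - s) * a + s * b) / ((1 - r) * a + r * b)
    \<le> ((1 - s) * a' + s * b') / ((1 - r) * a' + r * b')"
    and "((1 - r) * a' + r * b') / ((1 - s) * a' + s * b')
    \<le> ((1 - r) * a + r * b) / ((1 - s) * a + s * b)"
proof -
  have pos: "0 < (1 - t) * x + t * y" if "0 < x" "0 < y" "0 \<le> t" "t \<le> 1" for t x y :: real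
    using that by (cases "t = 0") (auto intro: add_nonneg_pos)
  have "b * a' \<le> b' * a"
    using assms by (simp add: field_simps)
  \<comment> \<open>This product is exactly the difference of the two sides of the cross-multiplied
    inequality below; both claims follow from it, as they compare reciprocal ratios.\<close>
  then have "0 \<le> (s - r) * (b' * a - b * a')"
    using assms by simp
  then have le: "((1 - s) * a + s * b) * ((1 - r) * a' + r * b')
      \<le> ((1 - s) * a' + s * b') * ((1 - r) * a + r * b)"
    by (simp add: algebra_simps)
  note P = pos[of a b r] pos[of a b s] pos[of a' b' r] pos[of a' b' s]
  show "((1 - s) * a + s * b) / ((1 - r) * a + r * b)
      \<le> ((1 - s) * a' + s * b') / ((1 - r) * a' + r * b')"
    using le P assms by (simp add: divide_le_eq le_divide_eq mult.commute)
  show "((1 - r) * a' + r * b') / ((1 - s) * a' + s * b')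
      \<le> ((1 - r) * a + r * b) / ((1 - s) * a + s * b)"
    using le P assms by (simp add: divide_le_eq le_divide_eq mult.commute)
qed

text \<open>Separates the metric argument from the geometry: \<open>X\<close> is any set of positive
  functions on a finite \<open>J\<close>, and the surface enters later only through the check that
  the rescaled segment stays in \<open>X\<close>.\<close>

lemma scaled_segment_bigeodesic:
  fixes u v :: "'p \<Rightarrow> real" and lam :: "real \<Rightarrow> real"
  assumes J: "finite J" "J \<noteq> {}" and X: "X \<subseteq> (J \<rightarrow>\<^sub>E {0<..})"
    and u: "u \<in> X" and v: "v \<in> X"
    and lam: "continuous_on {0..1} lam" "\<And>t. t \<in> {0..1} \<Longrightarrow> 0 < lam t"
    and \<alpha>: "\<And>t. t \<in> {0..1} \<Longrightarrow> (\<lambda>p\<in>J. lam t * ((1 - t) * u p + t * v p)) \<in> X"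
  shows "bigeodesic X (eta J) 0 1 (\<lambda>t. \<lambda>p\<in>J. lam t * ((1 - t) * u p + t * v p))"
    (is "bigeodesic X _ 0 1 ?\<alpha>")
proof -
  have pos: "0 < u p" "0 < v p" if "p \<in> J" for p
    using X u v that by (auto simp: PiE_iff)
  \<comment> \<open>A maximiser of \<open>v p / u p\<close>, found by minimising the negated ratio.
    Its logarithmic coordinate is the forward potential.\<close>
  obtain q where q: "q \<in> J" "\<And>p. p \<in> J \<Longrightarrow> v p / u p \<le> v q / u q"
    using ex_is_arg_min_if_finite[OF J, of "\<lambda>p. - (v p / u p)"] by (auto simp: is_arg_min_linorder)
  \<comment> \<open>Backwards, the coordinate ratios decrease as \<open>v p / u p\<close> grows, so
    the backward potential comes from a minimiser.\<close>
  obtain q' where q': "q' \<in> J" "\<And>p. p \<in> J \<Longrightarrow> v q' / u q' \<le> v p / u p"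
    using ex_is_arg_min_if_finite[OF J, of "\<lambda>p. v p / u p"] by (auto simp: is_arg_min_linorder)
  have \<alpha>pos: "0 < lam t * ((1 - t) * u p + t * v p)" if "t \<in> {0..1}" "p \<in> J" for t p
    using X \<alpha>[OF that(1)] that by (force simp: PiE_iff)
  \<comment> \<open>The factor \<open>lam s / lam r\<close> is common to all indices, so comparisons
    reduce to the unscaled segment. The order of \<open>r\<close> and \<open>s\<close> is left open,
    so that this serves both directions.\<close>
  have ratio: "?\<alpha> s p / ?\<alpha> r p \<le> ?\<alpha> s p' / ?\<alpha> r p'"
    if "p \<in> J" "p' \<in> J" "r \<in> {0..1}" "s \<in> {0..1}"
      "((1 - s) * u p + s * v p) / ((1 - r) * u p + r * v p)
        \<le> ((1 - s) * u p' + s * v p') / ((1 - r) * u p' + r * v p')" for p p' r s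
    using mult_left_mono[OF that(5), of "lam s / lam r"] lam(2)[OF that(3)] lam(2)[OF that(4)] that(1,2)
    by simp
  have cont: "continuous_on {0..1} (\<lambda>t. ln (?\<alpha> t p))" if "p \<in> J" for p
  proof -
    have "continuous_on {0..1} (\<lambda>t. ln (lam t * ((1 - t) * u p + t * v p)))"
      using \<alpha>pos[OF _ that] by (intro continuous_on_ln continuous_intros lam) fastforce
    then show ?thesis
      using that by simp
  qed
  show ?thesis
  proof (rule bigeodesicI_potential)
    show "Metric_space X (sym_dist X (eta J))"
      using J X by (rule Metric_space_sym_dist_eta)
    show "eta J (?\<alpha> r) (?\<alpha> s) = ln (?\<alpha> s q) - ln (?\<alpha> r q)" if "0 \<le> r" "r \<le> s" "s \<le> 1" for r s
    proof (rule eta_eqI[OF J(1) q(1)])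
      show "?\<alpha> s p / ?\<alpha> r p \<le> ?\<alpha> s q / ?\<alpha> r q" if "p \<in> J" for p
        using that q \<open>0 \<le> r\<close> \<open>r \<le> s\<close> \<open>s \<le> 1\<close>
        by (intro ratio segment_ratio_mono(1) pos) auto
    qed (use \<alpha>pos q(1) that in auto)
    show "eta J (?\<alpha> s) (?\<alpha> r) = ln (?\<alpha> r q') - ln (?\<alpha> s q')" if "0 \<le> r" "r \<le> s" "s \<le> 1" for r s
    proof (rule eta_eqI[OF J(1) q'(1)])
      show "?\<alpha> r p / ?\<alpha> s p \<le> ?\<alpha> r q' / ?\<alpha> s q'" if "p \<in> J" for p
        using that q' \<open>0 \<le> r\<close> \<open>r \<le> s\<close> \<open>s \<le> 1\<close>
        by (intro ratio segment_ratio_mono(2) pos) auto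
    qed (use \<alpha>pos q'(1) that in auto)
  qed (use \<alpha> cont[OF q(1)] cont[OF q'(1)] in auto)
qed

section \<open>Triples of faces, and the area function\<close>

lemma admissible_triples_cyclic:
  assumes "admissible_triples S T I e J" "(i, j, k) \<in> J"
  shows "(j, k, i) \<in> J" "(k, i, j) \<in> J"
  using assms unfolding admissible_triples_def by blast+

text \<open>Precompose the characteristic map with the reflection of the triangle that fixes 0 and
  exchanges 1 and \<open>\<i>\<close>: it preserves the side opposite 0 and exchanges the other
  two.\<close>

lemma face_with_edges_swap:
  assumes "face_with_edges S T f a b c"
  shows "face_with_edges S T f a c b"
proof -
  obtain \<phi> where \<phi>: "continuous_map (top_of_set std_triangle) S \<phi>"
      "bij_betw \<phi> (interior std_triangle) f" "bij_betw \<phi> (open_segment 1 \<i>) a"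
      "bij_betw \<phi> (open_segment \<i> 0) b" "bij_betw \<phi> (open_segment 0 1) c"
      "\<phi> ` {0, 1, \<i>} \<subseteq> verts T"
    and cells: "f \<in> faces T" "a \<in> edges T" "b \<in> edges T" "c \<in> edges T"
    using assms unfolding face_with_edges_def by blast
  \<comment> \<open>In coordinates this exchanges real and imaginary part.\<close>
  define \<rho> where "\<rho> z = \<i> * cnj z" for z
  have lin: "linear \<rho>"
    by (rule linearI) (auto simp: \<rho>_def algebra_simps scaleR_conv_of_real)
  have inj: "inj \<rho>"
    by (auto simp: inj_def \<rho>_def)
  have vals: "\<rho> 0 = 0" "\<rho> 1 = \<i>" "\<rho> \<i> = 1"
    by (auto simp: \<rho>_def)
  have tri: "\<rho> ` std_triangle = std_triangle"
    by (simp add: convex_hull_linear_image[OF lin] vals insert_commute)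
  have int: "\<rho> ` interior std_triangle = interior std_triangle"
    using interior_injective_linear_image[OF lin inj, of std_triangle] by (simp add: tri)
  have seg: "\<rho> ` open_segment x y = open_segment (\<rho> x) (\<rho> y)" for x y
    by (rule open_segment_linear_image[OF lin inj, symmetric])
  have bij: "bij_betw \<rho> A (\<rho> ` A)" for A
    using inj by (auto simp: bij_betw_def inj_on_def inj_def)
  have "continuous_map (top_of_set std_triangle) (top_of_set std_triangle) \<rho>"
    using tri lin by (auto simp: continuous_map_in_subtopology linear_continuous_on linear_linear)
  then have "continuous_map (top_of_set std_triangle) S (\<phi> \<circ> \<rho>)"
    using \<phi>(1) by (rule continuous_map_compose)
  moreover have "bij_betw (\<phi> \<circ> \<rho>) (interior std_triangle) f"
    by (rule bij_betw_trans[OF bij]) (simp add: int \<phi>)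
  moreover have "bij_betw (\<phi> \<circ> \<rho>) (open_segment 1 \<i>) a"
    using \<phi> by (intro bij_betw_trans[OF bij]) (simp add: seg vals open_segment_commute)
  moreover have "bij_betw (\<phi> \<circ> \<rho>) (open_segment \<i> 0) c"
    using \<phi> by (intro bij_betw_trans[OF bij]) (simp add: seg vals open_segment_commute)
  moreover have "bij_betw (\<phi> \<circ> \<rho>) (open_segment 0 1) b"
    using \<phi> by (intro bij_betw_trans[OF bij]) (simp add: seg vals open_segment_commute)
  moreover have "(\<phi> \<circ> \<rho>) ` {0, 1, \<i>} \<subseteq> verts T"
    using \<phi>(6) by (simp add: vals)
  ultimately show ?thesis
    using cells unfolding face_with_edges_def by blast
qed

text \<open>Ensures that the choice in \<open>surface_area\<close> picks a genuine triple of the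
  face. The order of edges given by a characteristic map may have the orientation excluded from
  \<open>J\<close>; swapping two edges repairs this.\<close>

lemma face_obtains_triple:
  assumes T: "finite_triangulation S T" and e: "bij_betw e I (edges T)"
    and J: "admissible_triples S T I e J" and f: "f \<in> faces T"
  obtains i j k where "(i, j, k) \<in> J" "face_with_edges S T f (e i) (e j) (e k)"
proof -
  obtain a b c where abc: "face_with_edges S T f a b c"
    using T f unfolding finite_triangulation_def by blast
  then have "a \<in> e ` I" "b \<in> e ` I" "c \<in> e ` I"
    unfolding bij_betw_imp_surj_on[OF e] face_with_edges_def by blast+
  then obtain i j k where I: "i \<in> I" "j \<in> I" "k \<in> I" and eq: "a = e i" "b = e j" "c = e k"
    by blast
  note ijk = abc[unfolded eq]
  have "J \<inter> {(i, j, k), (j, k, i), (k, i, j), (j, i, k), (i, k, j), (k, j, i)} \<noteq> {}"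
    using J I ijk unfolding admissible_triples_def by blast
  \<comment> \<open>The six permutations form two cyclic classes, represented by these two
    triples.\<close>
  then have "(i, j, k) \<in> J \<or> (i, k, j) \<in> J"
    using admissible_triples_cyclic[OF J] by blast
  then show thesis
    using that ijk face_with_edges_swap by metis
qed

text \<open>The chosen triple depends on the face but not on \<open>A\<close>. Scaling, positivity
  and continuity of the area thus reduce to one triangle at a time.\<close>

lemma surface_area_eq_sum:
  assumes "finite_triangulation S T" "bij_betw e I (edges T)" "admissible_triples S T I e J"
  obtains \<tau> where "\<tau> \<in> faces T \<rightarrow> J"
    "surface_area S T e J = (\<lambda>A. \<Sum>f\<in>faces T. triangle_area A (\<tau> f))"
proof -
  define \<tau> where
    "\<tau> f = (SOME (i, j, k). (i, j, k) \<in> J \<and> face_with_edges S T f (e i) (e j) (e k))" for f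
  have "\<tau> f \<in> J" if f: "f \<in> faces T" for f
  proof -
    obtain i j k where "(i, j, k) \<in> J" "face_with_edges S T f (e i) (e j) (e k)"
      using face_obtains_triple[OF assms f] .
    then have "\<exists>p. case p of (i, j, k) \<Rightarrow> (i, j, k) \<in> J \<and> face_with_edges S T f (e i) (e j) (e k)"
      by auto
    from someI_ex[OF this, folded \<tau>_def]
    have "case \<tau> f of (i, j, k) \<Rightarrow> (i, j, k) \<in> J \<and> face_with_edges S T f (e i) (e j) (e k)" .
    then show ?thesis by auto
  qed
  then show thesis
    by (intro that[of \<tau>]) (auto simp: surface_area_def \<tau>_def)
qed

text \<open>The radicand of Heron's formula is homogeneous of degree 4. Cyclic closure of
  \<open>J\<close> keeps all three arguments inside \<open>J\<close>, where the restriction does not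
  alter values.\<close>

lemma triangle_area_scale:
  assumes "admissible_triples S T I e J" "p \<in> J" "0 \<le> c"
  shows "triangle_area (\<lambda>p\<in>J. c * A p) p = c\<^sup>2 * triangle_area A p"
proof -
  obtain i j k where p: "p = (i, j, k)"
    by (cases p)
  let ?P = "(A (i, j, k) + A (j, k, i) + A (k, i, j)) * A (i, j, k) * A (j, k, i) * A (k, i, j)"
  have "triangle_area (\<lambda>p\<in>J. c * A p) p = sqrt ((c\<^sup>2)\<^sup>2 * ?P)"
    using admissible_triples_cyclic[of S T I e J i j k] assms
    by (simp add: p triangle_area_def algebra_simps power2_eq_square)
  also have "\<dots> = c\<^sup>2 * sqrt ?P"
    unfolding real_sqrt_mult real_sqrt_abs by simp
  finally show ?thesis
    by (simp add: p triangle_area_def)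
qed

lemma triangle_area_pos:
  assumes "admissible_triples S T I e J" "p \<in> J" "\<And>p. p \<in> J \<Longrightarrow> 0 < A p"
  shows "0 < triangle_area A p"
proof -
  obtain i j k where p: "p = (i, j, k)"
    by (cases p)
  show ?thesis
    using admissible_triples_cyclic[of S T I e J i j k] assms
    by (simp add: p triangle_area_def add_pos_pos)
qed

lemma continuous_on_triangle_area:
  assumes "admissible_triples S T I e J" "p \<in> J" "\<And>p. p \<in> J \<Longrightarrow> continuous_on K (\<lambda>t. A t p)"
  shows "continuous_on K (\<lambda>t. triangle_area (A t) p)"
proof -
  obtain i j k where p: "p = (i, j, k)"
    by (cases p)
  show ?thesis
    using admissible_triples_cyclic[OF assms(1), of i j k] assms(2)
    unfolding p triangle_area_def prod.case by (intro continuous_intros assms(3))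
qed

lemma surface_area_scale:
  assumes TeJ: "finite_triangulation S T" "bij_betw e I (edges T)" "admissible_triples S T I e J"
    and "0 \<le> c"
  shows "surface_area S T e J (\<lambda>p\<in>J. c * A p) = c\<^sup>2 * surface_area S T e J A"
proof -
  obtain \<tau> where "\<tau> \<in> faces T \<rightarrow> J"
    and area: "surface_area S T e J = (\<lambda>A. \<Sum>f\<in>faces T. triangle_area A (\<tau> f))"
    using surface_area_eq_sum[OF TeJ] .
  then show ?thesis
    unfolding area sum_distrib_left
    by (intro sum.cong triangle_area_scale[OF TeJ(3)] \<open>0 \<le> c\<close>) auto
qed

lemma surface_area_pos:
  assumes TeJ: "finite_triangulation S T" "bij_betw e I (edges T)" "admissible_triples S T I e J"
    and "faces T \<noteq> {}" and A: "\<And>p. p \<in> J \<Longrightarrow> 0 < A p"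
  shows "0 < surface_area S T e J A"
proof -
  obtain \<tau> where "\<tau> \<in> faces T \<rightarrow> J"
    and area: "surface_area S T e J = (\<lambda>A. \<Sum>f\<in>faces T. triangle_area A (\<tau> f))"
    using surface_area_eq_sum[OF TeJ] .
  then show ?thesis
    unfolding area using TeJ(1) \<open>faces T \<noteq> {}\<close>
    by (intro sum_pos triangle_area_pos[OF TeJ(3)] A) (auto simp: finite_triangulation_def)
qed

lemma continuous_on_surface_area:
  assumes TeJ: "finite_triangulation S T" "bij_betw e I (edges T)" "admissible_triples S T I e J"
    and A: "\<And>p. p \<in> J \<Longrightarrow> continuous_on K (\<lambda>t. A t p)"
  shows "continuous_on K (\<lambda>t. surface_area S T e J (A t))"
proof -
  obtain \<tau> where "\<tau> \<in> faces T \<rightarrow> J"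
    and area: "surface_area S T e J = (\<lambda>A. \<Sum>f\<in>faces T. triangle_area A (\<tau> f))"
    using surface_area_eq_sum[OF TeJ] .
  then show ?thesis
    unfolding area by (intro continuous_on_sum continuous_on_triangle_area[OF TeJ(3)] A) auto
qed

section \<open>The convex cone of metrics\<close>

text \<open>Positivity of the coordinates is the strict triangle inequality in a face realising the
  triple.\<close>

lemma metric_space_E_subset:
  assumes "admissible_triples S T I e J"
  shows "metric_space_E S T e J \<subseteq> (J \<rightarrow>\<^sub>E {0<..})"
proof
  fix A assume "A \<in> metric_space_E S T e J"
  then obtain l where l: "l \<in> edge_lengths S T" and A: "A = A_coords e J l"
    by (auto simp: metric_space_E_def)
  have "l (e i) < l (e j) + l (e k)" if ijk: "(i, j, k) \<in> J" for i j k
  proof -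
    obtain f where "face_with_edges S T f (e i) (e j) (e k)"
      using assms ijk unfolding admissible_triples_def by blast
    then show ?thesis
      using l unfolding edge_lengths_def by blast
  qed
  then show "A \<in> J \<rightarrow>\<^sub>E {0<..}"
    by (auto simp: A A_coords_def split: prod.splits)
qed

lemma restrict_metric_space_E:
  assumes "A \<in> metric_space_E S T e J"
  shows "restrict A J = A"
  using assms by (auto simp: metric_space_E_def A_coords_def)

text \<open>\<open>A_coords\<close> is linear in the edge lengths, and the constraints on these are
  homogeneous strict linear inequalities; so the operation can be carried out on the lengths. Sums
  are treated likewise.\<close>

lemma metric_space_E_scale:
  assumes "A \<in> metric_space_E S T e J" "0 < c"
  shows "(\<lambda>p\<in>J. c * A p) \<in> metric_space_E S T e J"
proof -
  obtain l where l: "l \<in> edge_lengths S T" and A: "A = A_coords e J l"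
    using assms by (auto simp: metric_space_E_def)
  have "(\<lambda>a. c * l a) \<in> edge_lengths S T"
    using l \<open>0 < c\<close> unfolding edge_lengths_def by (simp flip: distrib_left)
  moreover have "(\<lambda>p\<in>J. c * A p) = A_coords e J (\<lambda>a. c * l a)"
    by (rule ext) (auto simp: A A_coords_def algebra_simps restrict_def split: prod.splits)
  ultimately show ?thesis
    by (simp add: metric_space_E_def)
qed

lemma metric_space_E_add:
  assumes "A \<in> metric_space_E S T e J" "B \<in> metric_space_E S T e J"
  shows "(\<lambda>p\<in>J. A p + B p) \<in> metric_space_E S T e J"
proof -
  obtain l m where l: "l \<in> edge_lengths S T" "A = A_coords e J l"
    and m: "m \<in> edge_lengths S T" "B = A_coords e J m"
    using assms by (auto simp: metric_space_E_def)
  have "(\<lambda>a. l a + m a) \<in> edge_lengths S T"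
    unfolding edge_lengths_def
  proof (intro CollectI conjI allI impI ballI)
    fix f a b c assume "face_with_edges S T f a b c"
    then have "l a < l b + l c \<and> l b < l c + l a \<and> l c < l a + l b"
      "m a < m b + m c \<and> m b < m c + m a \<and> m c < m a + m b"
      using l(1) m(1) unfolding edge_lengths_def by blast+
    then show "l a + m a < l b + m b + (l c + m c)" "l b + m b < l c + m c + (l a + m a)"
      "l c + m c < l a + m a + (l b + m b)"
      by linarith+
  next
    fix a assume "a \<in> edges T"
    then show "0 < l a + m a"
      using l(1) m(1) by (simp add: edge_lengths_def add_pos_pos)
  qed
  moreover have "(\<lambda>p\<in>J. A p + B p) = A_coords e J (\<lambda>a. l a + m a)"
    by (rule ext) (auto simp: l m A_coords_def field_simps restrict_def split: prod.splits)
  ultimately show ?thesis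
    by (simp add: metric_space_E_def)
qed

lemma metric_space_E_segment:
  assumes J: "admissible_triples S T I e J"
    and u: "u \<in> metric_space_E S T e J" and v: "v \<in> metric_space_E S T e J" and t: "t \<in> {0..1}"
  shows "(\<lambda>p\<in>J. (1 - t) * u p + t * v p) \<in> metric_space_E S T e J"
proof -
  \<comment> \<open>Scaling needs a strictly positive factor, so the endpoints are treated apart;
    there extensionality of \<open>u\<close> and \<open>v\<close> suffices.\<close>
  consider "t = 0" | "t = 1" | "0 < t" "t < 1"
    using t by fastforce
  then show ?thesis
  proof cases
    case 3
    have "(\<lambda>p\<in>J. (\<lambda>p\<in>J. (1 - t) * u p) p + (\<lambda>p\<in>J. t * v p) p) \<in> metric_space_E S T e J"
      using 3 by (intro metric_space_E_add metric_space_E_scale u v) auto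
    then show ?thesis
      by (simp cong: restrict_cong)
  qed (use u v in \<open>simp_all add: restrict_metric_space_E\<close>)
qed

section \<open>Normalising the segment to unit area\<close>

theorem theorem4p4:
  fixes S :: "'s topology" and T :: "'s cell_triangulation"
    and I :: "'i set" and e :: "'i \<Rightarrow> 's set" and J :: "('i \<times> 'i \<times> 'i) set"
    and u v :: "'i \<times> 'i \<times> 'i \<Rightarrow> real"
  assumes "compact_surface S"
    and "finite_triangulation S T"
    and "bij_betw e I (edges T)"
    and "admissible_triples S T I e J"
    and "u \<in> metric_space_E1 S T e J"
    and "v \<in> metric_space_E1 S T e J"
  shows "\<exists>\<alpha>. bigeodesic (metric_space_E1 S T e J) (eta J) 0 1 \<alpha> \<and> joins 0 1 \<alpha> u v \<and>
           (\<exists>lam. (\<forall>t\<in>{0..1}. 0 < lam t) \<and>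
                (\<forall>t\<in>{0..1}. \<alpha> t = (\<lambda>p\<in>J. lam t * ((1 - t) * u p + t * v p))))"
proof -
  note TeJ = assms(2-4)
  let ?E = "metric_space_E S T e J" and ?E1 = "metric_space_E1 S T e J"
  have u: "u \<in> ?E" "surface_area S T e J u = 1" and v: "v \<in> ?E" "surface_area S T e J v = 1"
    using assms(5,6) by (auto simp: metric_space_E1_def)
  \<comment> \<open>Without faces the area would be an empty sum, not 1.\<close>
  have faces: "faces T \<noteq> {}"
    using u(2) by (auto simp: surface_area_def)
  then have "J \<noteq> {}"
    using face_obtains_triple[OF TeJ] by (metis ex_in_conv)
  have "finite I"
    using TeJ by (simp add: bij_betw_finite finite_triangulation_def)
  moreover have "J \<subseteq> I \<times> I \<times> I"
    using TeJ(3) unfolding admissible_triples_def by auto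
  ultimately have "finite J"
    by (meson finite_SigmaI finite_subset)
  define x where "x t = (\<lambda>p\<in>J. (1 - t) * u p + t * v p)" for t
  define area where "area t = surface_area S T e J (x t)" for t
  define lam where "lam t = 1 / sqrt (area t)" for t
  define \<alpha> where "\<alpha> t = (\<lambda>p\<in>J. lam t * ((1 - t) * u p + t * v p))" for t
  have x: "x t \<in> ?E" if "t \<in> {0..1}" for t
    unfolding x_def using metric_space_E_segment[OF TeJ(3) u(1) v(1) that] .
  have area_pos: "0 < area t" if "t \<in> {0..1}" for t
    unfolding area_def using x[OF that] metric_space_E_subset[OF TeJ(3)]
    by (intro surface_area_pos[OF TeJ faces]) (auto simp: PiE_iff)
  have lam_pos: "0 < lam t" if "t \<in> {0..1}" for t
    using area_pos[OF that] by (simp add: lam_def)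
  have "continuous_on {0..1} area"
    unfolding area_def
    by (rule continuous_on_surface_area[OF TeJ]) (auto simp: x_def intro!: continuous_intros)
  then have lam_cont: "continuous_on {0..1} lam"
    unfolding lam_def using area_pos by (force intro!: continuous_intros)
  have \<alpha>_eq: "\<alpha> t = (\<lambda>p\<in>J. lam t * x t p)" for t
    by (auto simp: \<alpha>_def x_def)
  have "\<alpha> t \<in> ?E1" if "t \<in> {0..1}" for t
  proof -
    have "surface_area S T e J (\<alpha> t) = (lam t)\<^sup>2 * area t"
      unfolding \<alpha>_eq area_def using lam_pos[OF that] by (intro surface_area_scale[OF TeJ]) simp
    then have "surface_area S T e J (\<alpha> t) = 1"
      using area_pos[OF that] by (simp add: lam_def power_divide)
    moreover have "\<alpha> t \<in> ?E"
      unfolding \<alpha>_eq using x[OF that] lam_pos[OF that] by (rule metric_space_E_scale)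
    ultimately show ?thesis
      by (simp add: metric_space_E1_def)
  qed
  moreover have "?E1 \<subseteq> (J \<rightarrow>\<^sub>E {0<..})"
    using metric_space_E_subset[OF TeJ(3)] by (auto simp: metric_space_E1_def)
  ultimately have "bigeodesic ?E1 (eta J) 0 1 \<alpha>"
    unfolding \<alpha>_def using \<open>finite J\<close> \<open>J \<noteq> {}\<close> assms(5,6) lam_cont lam_pos
    by (intro scaled_segment_bigeodesic)
  \<comment> \<open>Both endpoints already have area 1, so \<open>lam\<close> equals 1 there and the
    path starts at \<open>u\<close> and ends at \<open>v\<close>.\<close>
  moreover have "x 0 = u" "x 1 = v"
    using u(1) v(1) by (simp_all add: x_def restrict_metric_space_E)
  then have "joins 0 1 \<alpha> u v"
    using u v by (simp add: joins_def \<alpha>_eq lam_def area_def restrict_metric_space_E)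
  ultimately show ?thesis
    using lam_pos \<alpha>_def by blast
qed

end
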